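(* Let $G$ be a graph that admits a (nowhere-zero) $3$-flow. Then the following statements are equivalent: (a) $G$ is $3$-flow-connected. (b) $G$ is $\mathbb{Z}_3$-flow-connected. (c) $G$ is Eulerian and, for every two distinct vertices $w$ and $x$, $G$ contains at most $4$ edge-disjoint $w,x$-paths.
   Context: Graphs are finite; parallel edges are allowed. A graph is Eulerian if every vertex has even degree (connectedness is not required). A cycle is a connected 2-regular graph (two parallel edges form a cycle of length 2). Fix an arbitrary orientation $D$ of $G$; for a vertex $v$ let $E_D^+(v)$ and $E_D^-(v)$ be the sets of edges directed out of and into $v$. For an abelian group $A$, an $A$-flow on $G$ (always nowhere-zero here) is a function $f:E(G)\to A\setminus\{0_A\}$ with $\sum_{e\in E_D^+(v)}f(e)-\sum_{e\in E_D^-(v)}f(e)=0_A$ for every vertex $v$. For a positive integer $k$, a $k$-flow is a function $f:E(G)\to\mathbb{Z}$ satisfying the same conservation condition and $0<|f(e)|<k$ for all edges $e$. (Flows given with different orientations are identified by negating the value of every edge whose orientation is reversed, so the choice of $D$ does not matter.) Two $A$-flows (resp. $k$-flows) $f',f''$ are adjacent if there is a cycle $C$ in $G$ such that $f'(e)=f''(e)$ for all $e\notin E(C)$. Two $A$-flows (resp. $k$-flows) are equivalent if there is a finite sequence of $A$-flows (resp. $k$-flows) from one to the other in which consecutive flows are adjacent. $G$ is $A$-flow-connected (resp. $k$-flow-connected) if all its $A$-flows (resp. $k$-flows) are pairwise equivalent. *)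

theory Defs
  imports
    "Graph_Theory.Digraph_Component"
    "HOL-Library.FuncSet"
    "HOL-Library.Numeral_Type"
begin

text \<open>
  A finite undirected multigraph together with a fixed (arbitrary) orientation of its edges is
  a \<^term>\<open>fin_digraph\<close>: the edges are the arcs, and \<^term>\<open>tail\<close> and \<^term>\<open>head\<close> give the
  orientation. The orientation is used only in the conservation law for flows; degree, cycle and
  path below are those of the underlying undirected graph. Parallel edges are allowed, in either
  relative orientation. Loops are not excluded; a loop contributes two to the degree of its vertex.
\<close>

definition degree :: "('v, 'e) pre_digraph \<Rightarrow> 'v \<Rightarrow> nat" where
  "degree G v = in_degree G v + out_degree G v"

definition eulerian_graph :: "('v, 'e) pre_digraph \<Rightarrow> bool" where
  "eulerian_graph G \<longleftrightarrow> (\<forall>v \<in> verts G. even (degree G v))"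

text \<open>
  Note that \<^const>\<open>connected\<close> is weak connectedness, that is, connectedness of the underlying
  undirected graph, and that it includes having at least one vertex.
\<close>

definition cycle_in :: "('v, 'e) pre_digraph \<Rightarrow> ('v, 'e) pre_digraph \<Rightarrow> bool" where
  "cycle_in G C \<longleftrightarrow> subgraph C G \<and> connected C \<and> (\<forall>v \<in> verts C. degree C v = 2)"

text \<open>
  A path is given by its sequence of vertices and its sequence of edges; edges may be traversed
  against their orientation.
\<close>

definition path_between ::
    "('v, 'e) pre_digraph \<Rightarrow> 'v \<Rightarrow> 'v \<Rightarrow> 'v list \<times> 'e list \<Rightarrow> bool" where
  "path_between G w x = (\<lambda>(vs, es).
     length vs = Suc (length es) \<and> hd vs = w \<and> last vs = x \<and>
     distinct vs \<and> set vs \<subseteq> verts G \<and> set es \<subseteq> arcs G \<and>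
     (\<forall>i < length es. {tail G (es ! i), head G (es ! i)} = {vs ! i, vs ! Suc i}))"

definition edge_disjoint :: "('v list \<times> 'e list) set \<Rightarrow> bool" where
  "edge_disjoint P \<longleftrightarrow> pairwise (\<lambda>p q. disjnt (set (snd p)) (set (snd q))) P"

text \<open>
  Flows are extensional functions on the edge set, so that two flows are equal iff they agree on
  all edges of the graph.
\<close>

definition conserved :: "('v, 'e) pre_digraph \<Rightarrow> ('e \<Rightarrow> 'g :: ab_group_add) \<Rightarrow> bool" where
  "conserved G f \<longleftrightarrow>
     (\<forall>v \<in> verts G. (\<Sum>e \<in> out_arcs G v. f e) - (\<Sum>e \<in> in_arcs G v. f e) = 0)"

definition A_flow :: "('v, 'e) pre_digraph \<Rightarrow> ('e \<Rightarrow> 'g :: ab_group_add) \<Rightarrow> bool" where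
  "A_flow G f \<longleftrightarrow> f \<in> arcs G \<rightarrow>\<^sub>E UNIV - {0} \<and> conserved G f"

definition k_flow :: "nat \<Rightarrow> ('v, 'e) pre_digraph \<Rightarrow> ('e \<Rightarrow> int) \<Rightarrow> bool" where
  "k_flow k G f \<longleftrightarrow> f \<in> arcs G \<rightarrow>\<^sub>E {z. 0 < \<bar>z\<bar> \<and> \<bar>z\<bar> < int k} \<and> conserved G f"

definition adjacent_flows ::
    "('v, 'e) pre_digraph \<Rightarrow> ('e \<Rightarrow> 'g) \<Rightarrow> ('e \<Rightarrow> 'g) \<Rightarrow> bool" where
  "adjacent_flows G f f' \<longleftrightarrow> (\<exists>C. cycle_in G C \<and> (\<forall>e \<in> arcs G - arcs C. f e = f' e))"

text \<open>In the next two definitions, \<open>F\<close> is the property of being a flow of the kind considered.\<close>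

definition equivalent_flows ::
    "(('e \<Rightarrow> 'g) \<Rightarrow> bool) \<Rightarrow> ('v, 'e) pre_digraph \<Rightarrow> ('e \<Rightarrow> 'g) \<Rightarrow> ('e \<Rightarrow> 'g) \<Rightarrow> bool" where
  "equivalent_flows F G = (\<lambda>f f'. F f \<and> F f' \<and> adjacent_flows G f f')\<^sup>*\<^sup>*"

definition pairwise_equivalent ::
    "(('e \<Rightarrow> 'g) \<Rightarrow> bool) \<Rightarrow> ('v, 'e) pre_digraph \<Rightarrow> bool" where
  "pairwise_equivalent F G \<longleftrightarrow> (\<forall>f f'. F f \<longrightarrow> F f' \<longrightarrow> equivalent_flows F G f f')"

text \<open>
  The abelian group is a type of class \<^class>\<open>ab_group_add\<close>; the group of integers modulo 3 is the
  numeral type \<^typ>\<open>3\<close>, whose arithmetic is modulo 3.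
\<close>

definition A_flow_connected :: "'g :: ab_group_add itself \<Rightarrow> ('v, 'e) pre_digraph \<Rightarrow> bool" where
  "A_flow_connected _ G \<longleftrightarrow> pairwise_equivalent (A_flow G :: ('e \<Rightarrow> 'g) \<Rightarrow> bool) G"

definition k_flow_connected :: "nat \<Rightarrow> ('v, 'e) pre_digraph \<Rightarrow> bool" where
  "k_flow_connected k G \<longleftrightarrow> pairwise_equivalent (k_flow k G) G"

end

theory Submission
  imports Defs
begin

text \<open>
  Everything is read off from orientations. A nowhere-zero \<open>\<int>\<^sub>3\<close>-flow takes the values
  \<open>\<plusminus>1\<close>, so it is the same as an orientation of the graph in which the excess
  (out-degree minus in-degree) of every vertex is divisible by 3. Two facts describe equivalence of such
  flows.

  The excess is invariant. Adjacent flows differ by reversing some edges of a cycle, and since a vertex meets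
  at most two edge ends of the cycle, the excess changes there by one of \<open>0, \<plusminus>2,
  \<plusminus>4\<close>; being divisible by 3, the change is 0 (lemma \<open>excess_invariant\<close>).
  Conversely, if two orientations are balanced (all excesses are 0), the edges on which they differ form a
  balanced subdigraph; such a subdigraph splits into directed cycles, and reversing these one by one joins the
  two flows (lemma \<open>balanced_unit_flows_equivalent\<close>).

  A 3-flow is such an orientation together with a set \<open>F\<close> of edges: along the orientation the
  value is \<open>-2\<close> on \<open>F\<close> and \<open>1\<close> elsewhere, and conservation says that
  the excess in the whole graph is three times the excess in \<open>F\<close>. Reduction modulo 3 forgets
  \<open>F\<close>, so the excess is invariant for 3-flows too. Because a flow and its negative have opposite
  excesses, either kind of flow-connectedness forces all orientations concerned to be balanced.

  These facts give three implications that close a circle.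

  From \<open>\<int>\<^sub>3\<close>-flow-connected to 3-flow-connected: all orientations are balanced, hence
  so is every \<open>F\<close>; removing directed cycles from \<open>F\<close> leads to \<open>F = {}\<close>,
  and balanced orientations are joined by reversing directed cycles.

  From 3-flow-connected to the degree and path condition: the orientation of any 3-flow is balanced, so the
  degrees are even. If some \<open>w\<close> and \<open>x\<close> had five edge-disjoint paths, every cut
  between them would have more than 4 edges. Starting from a balanced orientation and reversing three directed
  paths from \<open>x\<close> to \<open>w\<close>, which exist because of the large cuts, one obtains an
  orientation with excess 6 at \<open>w\<close>, \<open>-6\<close> at \<open>x\<close> and 0 elsewhere. With
  \<open>F\<close> the union of two arc-disjoint directed \<open>w,x\<close>-paths this is a 3-flow, but it is
  not balanced.

  From that condition to \<open>\<int>\<^sub>3\<close>-flow-connected: by the same augmentation every two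
  vertices are separated by a cut of at most 4 edges. In an orientation belonging to a
  \<open>\<int>\<^sub>3\<close>-flow of an Eulerian graph all excesses are multiples of 6, so the excess of a
  vertex set with at most 4 boundary edges vanishes. The complement of a vertex \<open>v\<close> is covered by
  such sets, and by posimodularity of the cut function they can be made disjoint; hence the excess of the
  complement, and so that of \<open>v\<close>, is 0 (lemma \<open>balanced_if_small_cuts\<close>).
\<close>

section \<open>Orientations and the excess of a vertex\<close>

text \<open>
  The amount that a single edge adds to the excess of \<open>v\<close>. Summing it over all arcs treats loops,
  which add 0, and reversed edges, which change sign, uniformly.
\<close>

definition inc :: "('v, 'e) pre_digraph \<Rightarrow> 'v \<Rightarrow> 'e \<Rightarrow> int" where
  "inc G v e = of_bool (tail G e = v) - of_bool (head G e = v)"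

definition excess :: "('v, 'e) pre_digraph \<Rightarrow> 'v \<Rightarrow> int" where
  "excess G v = int (out_degree G v) - int (in_degree G v)"

definition balanced :: "('v, 'e) pre_digraph \<Rightarrow> bool" where
  "balanced G \<longleftrightarrow> (\<forall>v \<in> verts G. excess G v = 0)"

text \<open>
  An orientation of the edges of \<open>G\<close> is recorded by the set \<open>R\<close> of edges that it directs against \<open>G\<close>.
  In this encoding the edges on which two orientations differ are a symmetric difference, and the
  sign pattern of a flow is itself an orientation.
\<close>

definition reorient :: "('v, 'e) pre_digraph \<Rightarrow> 'e set \<Rightarrow> ('v, 'e) pre_digraph" where
  "reorient G R = G\<lparr>tail := (\<lambda>e. if e \<in> R then head G e else tail G e),
                    head := (\<lambda>e. if e \<in> R then tail G e else head G e)\<rparr>"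

definition edge_cut :: "('v, 'e) pre_digraph \<Rightarrow> 'v set \<Rightarrow> 'e set" where
  "edge_cut G S = {e \<in> arcs G. (tail G e \<in> S) \<noteq> (head G e \<in> S)}"

lemma reorient_simps [simp]:
  "verts (reorient G R) = verts G"
  "arcs (reorient G R) = arcs G"
  "tail (reorient G R) e = (if e \<in> R then head G e else tail G e)"
  "head (reorient G R) e = (if e \<in> R then tail G e else head G e)"
  by (simp_all add: reorient_def)

lemma reorient_reorient: "reorient (reorient G R) R' = reorient G (sym_diff R R')"
  by (auto simp: reorient_def fun_eq_iff)

lemma fin_digraph_reorient: "fin_digraph G \<Longrightarrow> fin_digraph (reorient G R)"
  by (simp add: fin_digraph_def fin_digraph_axioms_def wf_digraph_def)

lemma fin_digraph_restrict:
  "fin_digraph G \<Longrightarrow> F \<subseteq> arcs G \<Longrightarrow> fin_digraph (G\<lparr>arcs := F\<rparr>)"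
  by (auto simp: fin_digraph_def fin_digraph_axioms_def wf_digraph_def intro: finite_subset)

lemma edge_cut_reorient [simp]: "edge_cut (reorient G R) S = edge_cut G S"
  by (auto simp: edge_cut_def)

lemma inc_restrict [simp]: "inc (G\<lparr>arcs := F\<rparr>) = inc G"
  by (simp add: inc_def fun_eq_iff)

lemma inc_reorient: "inc (reorient G R) v e = (if e \<in> R then - inc G v e else inc G v e)"
  by (simp add: inc_def)

lemma excess_eq_sum_inc:
  assumes "finite (arcs G)"
  shows "excess G v = (\<Sum>e \<in> arcs G. inc G v e)"
proof -
  have "arcs G \<inter> {e. tail G e = v} = out_arcs G v" "arcs G \<inter> {e. head G e = v} = in_arcs G v"
    by auto
  with assms show ?thesis
    by (simp add: excess_def inc_def out_degree_def in_degree_def sum_subtractf of_bool_def sum.If_cases)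
qed

lemma excess_restrict:
  "finite F \<Longrightarrow> excess (G\<lparr>arcs := F\<rparr>) v = (\<Sum>e \<in> F. inc G v e)"
  by (subst excess_eq_sum_inc) auto

lemma excess_restrict_diff:
  assumes "finite F" "F' \<subseteq> F"
  shows "excess (G\<lparr>arcs := F - F'\<rparr>) v = excess (G\<lparr>arcs := F\<rparr>) v - excess (G\<lparr>arcs := F'\<rparr>) v"
  using assms by (simp add: excess_restrict finite_subset sum_diff)

lemma excess_reorient:
  assumes "finite (arcs G)" "F \<subseteq> arcs G"
  shows "excess (reorient G F) v = excess G v - 2 * excess (G\<lparr>arcs := F\<rparr>) v"
proof -
  have "finite F" using assms finite_subset by auto
  have "excess (reorient G F) v = (\<Sum>e \<in> arcs G. inc G v e - 2 * (if e \<in> F then inc G v e else 0))"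
    using assms(1) by (subst excess_eq_sum_inc) (auto simp: inc_reorient intro!: sum.cong)
  also have "\<dots> = excess G v - 2 * (\<Sum>e \<in> arcs G. if e \<in> F then inc G v e else 0)"
    using assms(1) by (simp add: excess_eq_sum_inc sum_subtractf sum_distrib_left)
  also have "(\<Sum>e \<in> arcs G. if e \<in> F then inc G v e else 0) = (\<Sum>e \<in> F. inc G v e)"
    using assms by (simp add: sum.If_cases Int_absorb1)
  finally show ?thesis using \<open>finite F\<close> by (simp add: excess_restrict)
qed

lemma degree_eq_sum:
  assumes "finite (arcs G)"
  shows "int (degree G v) = (\<Sum>e \<in> arcs G. of_bool (tail G e = v) + of_bool (head G e = v))"
proof -
  have "arcs G \<inter> {e. tail G e = v} = out_arcs G v" "arcs G \<inter> {e. head G e = v} = in_arcs G v"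
    by auto
  with assms show ?thesis
    by (simp add: degree_def out_degree_def in_degree_def sum.distrib of_bool_def sum.If_cases)
qed

lemma degree_reorient:
  assumes "finite (arcs G)"
  shows "degree (reorient G R) v = degree G v"
proof -
  have "int (degree (reorient G R) v) = int (degree G v)"
    using assms by (subst (1 2) degree_eq_sum) (auto intro!: sum.cong)
  then show ?thesis by simp
qed

lemma even_excess_iff_even_degree: "even (excess G v) \<longleftrightarrow> even (degree G v)"
  by (auto simp: excess_def degree_def)

section \<open>Cuts and reachability\<close>

lemma sum_excess:
  assumes "finite (arcs G)" "finite S"
  shows "(\<Sum>v \<in> S. excess G v) = (\<Sum>e \<in> arcs G. of_bool (tail G e \<in> S) - of_bool (head G e \<in> S))"
proof -
  have "(\<Sum>v \<in> S. excess G v) = (\<Sum>e \<in> arcs G. \<Sum>v \<in> S. inc G v e)"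
    using assms by (simp add: excess_eq_sum_inc sum.swap[of _ S])
  also have "\<dots> = (\<Sum>e \<in> arcs G. of_bool (tail G e \<in> S) - of_bool (head G e \<in> S))"
    using assms(2) by (simp add: inc_def sum_subtractf of_bool_def)
  finally show ?thesis .
qed

lemma card_edge_cut_eq_sum:
  "finite (arcs G) \<Longrightarrow> int (card (edge_cut G S)) = (\<Sum>e \<in> arcs G. of_bool ((tail G e \<in> S) \<noteq> (head G e \<in> S)))"
  by (simp add: edge_cut_def of_bool_def sum.If_cases Int_def)

lemma abs_sum_excess_le_card_edge_cut:
  assumes "finite (arcs G)" "finite S"
  shows "\<bar>\<Sum>v \<in> S. excess G v\<bar> \<le> int (card (edge_cut G S))"
  unfolding sum_excess[OF assms] card_edge_cut_eq_sum[OF assms(1)]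
  by (rule order_trans[OF sum_abs]) (auto intro!: sum_mono)

lemma sum_excess_no_arcs_leave:
  assumes "finite (arcs G)" "finite S" "\<And>e. e \<in> arcs G \<Longrightarrow> tail G e \<in> S \<Longrightarrow> head G e \<in> S"
  shows "(\<Sum>v \<in> S. excess G v) = - int (card (edge_cut G S))"
  unfolding sum_excess[OF assms(1,2)] card_edge_cut_eq_sum[OF assms(1)]
  using assms(3) by (auto simp: sum_negf[symmetric] intro!: sum.cong)


lemma sum_excess_verts: "fin_digraph G \<Longrightarrow> (\<Sum>v \<in> verts G. excess G v) = 0"
  by (simp add: sum_excess fin_digraph.finite_arcs fin_digraph.finite_verts
      wf_digraph.tail_in_verts wf_digraph.head_in_verts fin_digraph_def)

lemma reachable_subset_verts: "{v. u \<rightarrow>\<^sup>*\<^bsub>G\<^esub> v} \<subseteq> verts G"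
  by (auto elim: reachable_in_vertsE)

text \<open>
  No arc leaves the set of vertices reachable from \<open>u\<close>, so its excess counts all its boundary edges
  negatively. This is the source of every directed path and cycle constructed below.
\<close>

lemma sum_excess_reachable:
  assumes "fin_digraph G"
  shows "(\<Sum>v | u \<rightarrow>\<^sup>*\<^bsub>G\<^esub> v. excess G v) = - int (card (edge_cut G {v. u \<rightarrow>\<^sup>*\<^bsub>G\<^esub> v}))"
proof -
  interpret fin_digraph G by fact
  show ?thesis
  proof (rule sum_excess_no_arcs_leave)
    show "finite {v. u \<rightarrow>\<^sup>*\<^bsub>G\<^esub> v}"
      using reachable_subset_verts by (rule finite_subset) simp
    show "head G e \<in> {v. u \<rightarrow>\<^sup>*\<^bsub>G\<^esub> v}" if "e \<in> arcs G" "tail G e \<in> {v. u \<rightarrow>\<^sup>*\<^bsub>G\<^esub> v}" for e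
      using that reachable_adj_trans in_arcs_imp_in_arcs_ends by blast
  qed simp
qed

lemma apath_from_source_to_sink:
  assumes "fin_digraph G" "u \<in> verts G" "excess G u > 0"
  obtains v p where "v \<in> verts G" "excess G v < 0" "pre_digraph.apath G u p v"
proof -
  interpret fin_digraph G by fact
  have "\<exists>v. u \<rightarrow>\<^sup>*\<^bsub>G\<^esub> v \<and> excess G v < 0"
  proof (rule ccontr)
    assume "\<nexists>v. u \<rightarrow>\<^sup>*\<^bsub>G\<^esub> v \<and> excess G v < 0"
    then have "excess G u \<le> (\<Sum>v | u \<rightarrow>\<^sup>*\<^bsub>G\<^esub> v. excess G v)"
      using assms finite_subset[OF reachable_subset_verts finite_verts]
      by (intro member_le_sum) (auto simp: not_less)
    then show False using sum_excess_reachable[OF assms(1), of u] assms(3) by simp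
  qed
  then show thesis using that reachable_apath reachable_in_verts by metis
qed

section \<open>Directed paths\<close>

lemma excess_trail:
  assumes "fin_digraph G" "pre_digraph.awalk G u p v" "distinct p"
  shows "excess (G\<lparr>arcs := set p\<rparr>) x = of_bool (x = u) - of_bool (x = v)"
proof -
  interpret fin_digraph G by fact
  have "cas u p v \<Longrightarrow> distinct p \<Longrightarrow> (\<Sum>e \<in> set p. inc G x e) = of_bool (x = u) - of_bool (x = v)" for u
    by (induction p arbitrary: u) (auto simp: inc_def)
  with assms show ?thesis by (auto simp: excess_restrict awalk_def)
qed

lemma excess_apath:
  assumes "fin_digraph G" "pre_digraph.apath G u p v"
  shows "excess (G\<lparr>arcs := set p\<rparr>) x = of_bool (x = u) - of_bool (x = v)"
proof -
  interpret fin_digraph G by fact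
  have "awalk u p v" "distinct p"
    using assms(2) distinct_verts_imp_distinct by (auto simp: apath_def)
  then show ?thesis by (rule excess_trail[OF assms(1)])
qed

lemma excess_reverse_apath:
  assumes "fin_digraph G" "pre_digraph.apath G u p v"
  shows "excess (reorient G (set p)) x = excess G x - 2 * (of_bool (x = u) - of_bool (x = v))"
proof -
  interpret fin_digraph G by fact
  have "set p \<subseteq> arcs G" using assms(2) by (auto simp: apath_def)
  then show ?thesis using excess_apath[OF assms] by (simp add: excess_reorient)
qed

text \<open>
  The paths are found greedily: a source has a directed path to a sink, \<open>v\<close> is the only possible
  sink, and deleting the path lowers the excess of \<open>u\<close> by one, raises that of \<open>v\<close> and changes no
  other.
\<close>

lemma arc_disjoint_apaths:
  assumes "fin_digraph G" "u \<in> verts G" "u \<noteq> v" "excess G u \<ge> int k"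
    and "\<And>x. x \<in> verts G \<Longrightarrow> x \<noteq> v \<Longrightarrow> excess G x \<ge> 0"
  shows "\<exists>P. finite P \<and> card P = k \<and> (\<forall>p \<in> P. pre_digraph.apath G u p v) \<and>
    pairwise (\<lambda>p q. disjnt (set p) (set q)) P"
  using assms
proof (induction k arbitrary: G)
  case 0
  then show ?case by (intro exI[of _ "{}"]) auto
next
  case (Suc k)
  interpret fin_digraph G by fact
  obtain v' p where "v' \<in> verts G" "excess G v' < 0" "apath u p v'"
    using apath_from_source_to_sink[OF Suc.prems(1,2)] Suc.prems(4) by auto
  moreover from this have "v' = v" using Suc.prems(5)[of v'] by fastforce
  ultimately have path: "apath u p v" by simp
  then have p: "set p \<subseteq> arcs G" by (auto simp: apath_def)
  let ?H = "G\<lparr>arcs := arcs G - set p\<rparr>"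
  have ex: "excess ?H x = excess G x - (of_bool (x = u) - of_bool (x = v))" for x
    using excess_restrict_diff[of "arcs G" "set p" G x] p path
    by (simp add: excess_apath[OF Suc.prems(1)])
  interpret H: fin_digraph ?H
    by (rule fin_digraph_restrict[OF Suc.prems(1)]) auto
  have sub: "subgraph ?H G"
    by (intro subgraphI) (auto simp: compatible_def wf_digraph H.wf_digraph)
  have "\<exists>P. finite P \<and> card P = k \<and> (\<forall>q \<in> P. pre_digraph.apath ?H u q v) \<and>
      pairwise (\<lambda>p q. disjnt (set p) (set q)) P"
    by (rule Suc.IH) (use Suc.prems H.fin_digraph_axioms in \<open>auto simp: ex\<close>)
  then obtain P where P: "finite P" "card P = k" "\<And>q. q \<in> P \<Longrightarrow> pre_digraph.apath ?H u q v"
      "pairwise (\<lambda>p q. disjnt (set p) (set q)) P"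
    by blast
  have dis: "disjnt (set q) (set p)" if "q \<in> P" for q
    using P(3)[OF that] by (auto simp: pre_digraph.apath_def pre_digraph.awalk_def disjnt_def)
  have "p \<noteq> []" using path Suc.prems(3) by (auto simp: apath_Nil_iff)
  then have "p \<notin> P" using dis[of p] by (auto simp: disjnt_def)
  have "apath u q v" if "q \<in> P" for q
    using subgraph_apath_imp_apath[OF P(3)[OF that] sub] .
  then show ?case
    using P path dis \<open>p \<notin> P\<close>
    by (intro exI[of _ "insert p P"]) (auto simp: pairwise_insert disjnt_sym)
qed

lemma reorient_empty [simp]: "reorient G {} = G"
  by (simp add: reorient_def)

text \<open>
  Reversing a directed path from a source to a sink brings both excesses, which are even and
  therefore at least 2 in absolute value, closer to 0.
\<close>

lemma eulerian_has_balanced_orientation: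
  assumes "fin_digraph G" "eulerian_graph G"
  shows "\<exists>R. balanced (reorient G R)"
  using assms
proof (induction "nat (\<Sum>v \<in> verts G. \<bar>excess G v\<bar>)" arbitrary: G rule: less_induct)
  case less
  interpret fin_digraph G by fact
  show ?case
  proof (cases "\<forall>v \<in> verts G. excess G v \<le> 0")
    case True
    have "(\<Sum>v \<in> verts G. - excess G v) = 0"
      using sum_excess_verts[OF less.prems(1)] by (simp add: sum_negf)
    then have "\<forall>v \<in> verts G. - excess G v = 0"
      using True by (subst (asm) sum_nonneg_eq_0_iff) auto
    then show ?thesis by (intro exI[of _ "{}"]) (simp add: balanced_def)
  next
    case False
    then obtain u where u: "u \<in> verts G" "excess G u > 0" by auto
    obtain v p where v: "v \<in> verts G" "excess G v < 0" "apath u p v"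
      using apath_from_source_to_sink[OF less.prems(1) u] .
    have ev: "even (excess G x)" if "x \<in> verts G" for x
      using that less.prems(2) by (simp add: eulerian_graph_def even_excess_iff_even_degree)
    let ?H = "reorient G (set p)"
    have ex: "excess ?H x = excess G x - 2 * (of_bool (x = u) - of_bool (x = v))" for x
      using excess_reverse_apath[OF less.prems(1) v(3)] .
    have "excess G u \<ge> 2" "excess G v \<le> -2" "u \<noteq> v"
      using ev[OF u(1)] ev[OF v(1)] u(2) v(2) by (auto elim!: evenE)
    then have "(\<Sum>x \<in> verts G. \<bar>excess ?H x\<bar>) < (\<Sum>x \<in> verts G. \<bar>excess G x\<bar>)"
      using u(1) by (intro sum_strict_mono_ex1) (auto simp: ex)
    moreover have "0 \<le> (\<Sum>x \<in> verts G. \<bar>excess ?H x\<bar>)" by (simp add: sum_nonneg)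
    ultimately have "nat (\<Sum>x \<in> verts ?H. \<bar>excess ?H x\<bar>) < nat (\<Sum>x \<in> verts G. \<bar>excess G x\<bar>)"
      by (subst nat_less_eq_zless) simp_all
    then have "\<exists>R. balanced (reorient ?H R)"
      using less.prems
      by (intro less.hyps) (simp_all add: fin_digraph_reorient eulerian_graph_def degree_reorient)
    then show ?thesis by (auto simp: reorient_reorient)
  qed
qed

text \<open>
  This is the augmentation step of Menger's theorem. If \<open>w\<close> cannot be reached from \<open>x\<close>, then the
  vertices that cannot be reached from \<open>x\<close> form a cut whose size is exactly the excess \<open>k\<close>;
  otherwise a path from \<open>x\<close> to \<open>w\<close> can be reversed.
\<close>

lemma augment_excess:
  assumes G: "fin_digraph G" and wx: "w \<in> verts G" "x \<in> verts G" "w \<noteq> x"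
    and k: "excess G w = k" "\<And>v. v \<in> verts G - {w, x} \<Longrightarrow> excess G v = 0"
    and cuts: "\<And>T. T \<subseteq> verts G \<Longrightarrow> w \<in> T \<Longrightarrow> x \<notin> T \<Longrightarrow> int (card (edge_cut G T)) > k"
  shows "\<exists>R. excess (reorient G R) w = k + 2 \<and> (\<forall>v \<in> verts G - {w, x}. excess (reorient G R) v = 0)"
proof -
  interpret fin_digraph G by fact
  let ?S = "{v. x \<rightarrow>\<^sup>*\<^bsub>G\<^esub> v}"
  have fin: "finite ?S" using reachable_subset_verts by (rule finite_subset) simp
  have "w \<in> ?S"
  proof (rule ccontr)
    assume w: "w \<notin> ?S"
    have "(\<Sum>v \<in> verts G. excess G v) = (\<Sum>v \<in> {w, x}. excess G v)"
      using wx k(2) by (intro sum.mono_neutral_right) auto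
    then have "excess G x = - k"
      using sum_excess_verts[OF G] wx k(1) by simp
    moreover have "(\<Sum>v \<in> ?S. excess G v) = (\<Sum>v \<in> {x}. excess G v)"
      using w wx k(2) fin reachable_subset_verts[of G x] by (intro sum.mono_neutral_right) auto
    ultimately have "int (card (edge_cut G ?S)) = k"
      using sum_excess_reachable[OF G, of x] by simp
    moreover have "edge_cut G (verts G - ?S) = edge_cut G ?S"
      by (auto simp: edge_cut_def)
    ultimately show False
      using cuts[of "verts G - ?S"] w wx by auto
  qed
  then obtain p where "apath x p w" using reachable_apath by blast
  then have "excess (reorient G (set p)) v = excess G v - 2 * (of_bool (v = x) - of_bool (v = w))" for v
    using excess_reverse_apath[OF G] by blast
  with k wx show ?thesis by (intro exI[of _ "set p"]) auto
qed

text \<open>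
  Three augmentations raise the excess of \<open>w\<close> from 0 through 2 and 4 to 6; the last one, starting at
  4, is why the cuts must have more than 4 edges.
\<close>

lemma orientation_excess_6:
  assumes G: "fin_digraph G" "eulerian_graph G" and wx: "w \<in> verts G" "x \<in> verts G" "w \<noteq> x"
    and cuts: "\<And>T. T \<subseteq> verts G \<Longrightarrow> w \<in> T \<Longrightarrow> x \<notin> T \<Longrightarrow> card (edge_cut G T) > 4"
  shows "\<exists>R. excess (reorient G R) w = 6 \<and> (\<forall>v \<in> verts G - {w, x}. excess (reorient G R) v = 0)"
proof -
  have step: "\<exists>R. excess (reorient G R) w = k + 2 \<and> (\<forall>v \<in> verts G - {w, x}. excess (reorient G R) v = 0)"
    if ex: "\<exists>R. excess (reorient G R) w = k \<and> (\<forall>v \<in> verts G - {w, x}. excess (reorient G R) v = 0)"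
      and "k \<le> 4" for k
  proof -
    obtain R where "excess (reorient G R) w = k" "\<forall>v \<in> verts G - {w, x}. excess (reorient G R) v = 0"
      using ex by blast
    moreover have "int (card (edge_cut G T)) > k" if "T \<subseteq> verts G" "w \<in> T" "x \<notin> T" for T
      using cuts[OF that] \<open>k \<le> 4\<close> by linarith
    ultimately have "\<exists>R'. excess (reorient (reorient G R) R') w = k + 2 \<and>
        (\<forall>v \<in> verts (reorient G R) - {w, x}. excess (reorient (reorient G R) R') v = 0)"
      using G(1) wx by (intro augment_excess) (auto simp: fin_digraph_reorient)
    then show ?thesis by (auto simp: reorient_reorient)
  qed
  have "\<exists>R. excess (reorient G R) w = 0 \<and> (\<forall>v \<in> verts G - {w, x}. excess (reorient G R) v = 0)"
    using eulerian_has_balanced_orientation[OF G] wx by (auto simp: balanced_def)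
  from step[OF this] have "\<exists>R. excess (reorient G R) w = 2 \<and> (\<forall>v \<in> verts G - {w, x}. excess (reorient G R) v = 0)"
    by simp
  from step[OF this] have "\<exists>R. excess (reorient G R) w = 4 \<and> (\<forall>v \<in> verts G - {w, x}. excess (reorient G R) v = 0)"
    by simp
  from step[OF this] show ?thesis by simp
qed

section \<open>Directed cycles\<close>

lemma arcs_ends_reorient: "(arcs_ends (reorient G R))\<^sup>s = (arcs_ends G)\<^sup>s"
  by (auto simp: symcl_def arcs_ends_conv image_iff split: if_splits) metis+

lemma connected_reorient: "connected (reorient G R) \<longleftrightarrow> connected G"
  by (simp add: connected_conv arcs_ends_reorient)

lemma card_fiber_distinct_map:
  assumes "distinct (map f xs)" "y \<in> f ` set xs"
  shows "card {x \<in> set xs. f x = y} = 1"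
proof -
  from assms(2) obtain x where "x \<in> set xs" "f x = y" by auto
  moreover have "inj_on f (set xs)" using assms(1) by (simp add: distinct_map)
  ultimately have "{x \<in> set xs. f x = y} = {x}" by (auto dest: inj_onD)
  then show ?thesis by simp
qed

text \<open>
  Closing a directed path by an arc gives a cycle of the underlying graph. The tails of its arcs are
  pairwise distinct, and so are the heads, so each of its vertices has exactly one outgoing and one
  incoming arc.
\<close>

lemma cycle_from_directed_cycle:
  assumes G: "fin_digraph G"
    and e: "e \<in> arcs G" and p: "pre_digraph.apath (reorient G R) (head (reorient G R) e) p (tail (reorient G R) e)"
  shows "\<exists>C. cycle_in G C \<and> arcs C = insert e (set p)"
    and "excess (reorient G R\<lparr>arcs := insert e (set p)\<rparr>) v = 0"
proof -
  let ?K = "reorient G R"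
  interpret K: fin_digraph ?K using G by (rule fin_digraph_reorient)
  have aw: "K.awalk (head ?K e) p (tail ?K e)" and dv: "distinct (K.awalk_verts (head ?K e) p)"
    using p by (auto simp: K.apath_def)
  then have sub: "set p \<subseteq> arcs G" and cas: "K.cas (head ?K e) p (tail ?K e)"
    by (auto simp: K.awalk_def)
  let ?q = "e # p"
  have aw': "K.awalk (tail ?K e) ?q (tail ?K e)"
    using aw e by (auto simp: K.awalk_Cons_iff simp del: reorient_simps(3,4))
  have heads: "map (head ?K) ?q = K.awalk_verts (head ?K e) p"
    using K.awalk_verts_conv'[OF cas] cas by (auto simp: K.cas_simp simp del: reorient_simps(3,4))
  have "K.awalk_verts (head ?K e) p = map (tail ?K) p @ [tail ?K e]"
    using K.awalk_verts_conv[of "head ?K e" p] cas K.awlast_if_cas[OF cas]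
    by (cases "p = []") (auto simp del: reorient_simps(3,4))
  then have dt: "distinct (map (tail ?K) ?q)" and vt: "set (map (tail ?K) ?q) = set (K.awalk_verts (head ?K e) p)"
    using dv by (auto simp del: reorient_simps(3,4))
  have dh: "distinct (map (head ?K) ?q)" using dv heads by metis
  define V where "V = set (K.awalk_verts (head ?K e) p)"
  have "distinct ?q" using dt unfolding distinct_map by blast
  then show "excess (?K\<lparr>arcs := insert e (set p)\<rparr>) v = 0"
    using excess_trail[OF K.fin_digraph_axioms aw'] by simp
  \<comment> \<open>The cycle must inherit the given orientation of \<open>G\<close>; degrees and connectedness are computed in its reorientation, where \<open>e # p\<close> is a directed walk.\<close>
  define C where "C = G\<lparr>verts := V, arcs := set ?q\<rparr>"
  have VC: "verts C = V" "arcs C = set ?q" "tail C = tail G" "head C = head G"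
    by (simp_all add: C_def)
  have wfK: "wf_digraph (reorient C R)"
  proof
    fix a assume "a \<in> arcs (reorient C R)"
    then have "a \<in> set ?q" by (simp add: VC)
    then have "tail ?K a \<in> V" "head ?K a \<in> V"
      unfolding V_def using vt arg_cong[OF heads, of set] by auto
    then show "tail (reorient C R) a \<in> verts (reorient C R)" "head (reorient C R) a \<in> verts (reorient C R)"
      by (simp_all add: VC split: if_splits)
  qed
  then interpret KC: wf_digraph "reorient C R" .
  have wfC: "wf_digraph C"
    using wfK by (auto simp: wf_digraph_def split: if_splits)
  have "V \<subseteq> verts G"
    unfolding V_def using K.awalkE[OF aw] reorient_simps(1) by metis
  then have subg: "subgraph C G"
    using sub e wfC fin_digraph.axioms(1)[OF G] by (simp add: subgraph_def VC compatible_def)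
  have deg: "degree C v = 2" if "v \<in> V" for v
  proof -
    have "in_degree (reorient C R) v = card {a \<in> set ?q. head ?K a = v}"
         "out_degree (reorient C R) v = card {a \<in> set ?q. tail ?K a = v}"
      by (simp_all only: in_degree_def out_degree_def in_arcs_def out_arcs_def reorient_simps VC)
    moreover have "v \<in> tail ?K ` set ?q" "v \<in> head ?K ` set ?q"
      using that vt arg_cong[OF heads, of set] unfolding V_def by (auto simp del: reorient_simps(3,4))
    ultimately have "degree (reorient C R) v = 2"
      using card_fiber_distinct_map[OF dt, of v] card_fiber_distinct_map[OF dh, of v]
      by (simp add: degree_def)
    then show ?thesis by (simp add: degree_reorient VC)
  qed
  have awC: "KC.awalk (head ?K e) p (tail ?K e)"
  proof -
    have "KC.cas u p' v = K.cas u p' v" for u p' v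
      by (induction p' arbitrary: u) (auto simp: VC pre_digraph.cas.simps)
    then show ?thesis
      using cas K.hd_in_awalk_verts(1)[OF aw] by (simp add: KC.awalk_def VC V_def subset_insertI)
  qed

  have reach: "tail ?K e \<rightarrow>\<^sup>*\<^bsub>reorient C R\<^esub> v \<and> v \<rightarrow>\<^sup>*\<^bsub>reorient C R\<^esub> tail ?K e" if "v \<in> V" for v
  proof -
    have eq: "KC.awalk_verts u p' = K.awalk_verts u p'" for u p'
      by (induction p' arbitrary: u) (auto simp: VC pre_digraph.awalk_verts.simps)
    have v: "v \<in> set (KC.awalk_verts (head ?K e) p)"
      using that by (simp add: V_def eq)
    have "e \<in> arcs (reorient C R)" by (simp add: VC)
    moreover have "tail (reorient C R) e = tail ?K e" "head (reorient C R) e = head ?K e"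
      by (simp_all add: VC)
    ultimately have "tail ?K e \<rightarrow>\<^bsub>reorient C R\<^esub> head ?K e"
      by (metis KC.in_arcs_imp_in_arcs_ends)
    then show ?thesis
      using KC.awalk_verts_reachable_from[OF awC v] KC.awalk_verts_reachable_to[OF awC v]
        KC.adj_reachable_trans by blast
  qed
  have "connected (reorient C R)"
  proof (rule KC.connectedI)
    show "verts (reorient C R) \<noteq> {}" by (simp add: VC V_def)
    show "u \<rightarrow>\<^sup>*\<^bsub>with_proj (mk_symmetric (reorient C R))\<^esub> v"
      if "u \<in> verts (reorient C R)" "v \<in> verts (reorient C R)" for u v
      using that reach[of u] reach[of v] KC.reachable_mk_symmetricI KC.reachable_trans
      by (metis VC(1) reorient_simps(1))
  qed
  with subg deg show "\<exists>C. cycle_in G C \<and> arcs C = insert e (set p)"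
    by (intro exI[of _ C]) (auto simp: cycle_in_def connected_reorient VC)
qed

text \<open>
  In a balanced digraph the vertices reachable from the head of an arc \<open>e\<close> have an empty cut, so the
  tail of \<open>e\<close> is among them and \<open>e\<close> lies on a directed cycle.
\<close>

lemma balanced_contains_cycle:
  assumes G: "fin_digraph G" and F: "F \<subseteq> arcs G" "F \<noteq> {}" "balanced (reorient G R\<lparr>arcs := F\<rparr>)"
  obtains Z C where "Z \<subseteq> F" "Z \<noteq> {}" "cycle_in G C" "arcs C = Z" "balanced (reorient G R\<lparr>arcs := Z\<rparr>)"
proof -
  let ?K = "reorient G R" and ?H = "reorient G R\<lparr>arcs := F\<rparr>"
  have K: "fin_digraph ?K" using G by (rule fin_digraph_reorient)
  then interpret K: fin_digraph ?K .
  have H: "fin_digraph ?H" using fin_digraph_restrict[OF K] F(1) by simp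
  then interpret H: fin_digraph ?H .
  obtain e where e: "e \<in> F" using F(2) by blast
  let ?S = "{v. head ?K e \<rightarrow>\<^sup>*\<^bsub>?H\<^esub> v}"
  have "(\<Sum>v \<in> ?S. excess ?H v) = 0"
    using F(3) reachable_subset_verts[of ?H] by (intro sum.neutral) (auto simp: balanced_def)
  moreover have "finite (edge_cut ?H ?S)"
    using H.finite_arcs by (rule rev_finite_subset) (auto simp: edge_cut_def)
  ultimately have "edge_cut ?H ?S = {}"
    using sum_excess_reachable[OF H, of "head ?K e"] by simp
  moreover have "head ?H e \<in> ?S" using H.head_in_verts[of e] e by (auto split: if_splits)
  ultimately have "tail ?H e \<in> ?S" using e by (auto simp: edge_cut_def)
  then obtain p where p: "H.apath (head ?K e) p (tail ?K e)"
    using H.reachable_apath by auto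
  have "subgraph ?H ?K"
    using F(1) K H by (auto simp: subgraph_def compatible_def fin_digraph_def)
  from K.subgraph_apath_imp_apath[OF p this] have p': "K.apath (head ?K e) p (tail ?K e)" .
  have "set p \<subseteq> F" using p by (auto simp: H.apath_def H.awalk_def)
  obtain C where "cycle_in G C" "arcs C = insert e (set p)"
    using cycle_from_directed_cycle(1)[OF G _ p'] e F(1) by blast
  then show thesis
    using that[of "insert e (set p)" C] e \<open>set p \<subseteq> F\<close> F(1) cycle_from_directed_cycle(2)[OF G _ p']
    by (auto simp: balanced_def)
qed

section \<open>Flows as orientations\<close>

lemma excess_reorient_eq_sum:
  "finite (arcs G) \<Longrightarrow> excess (reorient G R) v = (\<Sum>e \<in> arcs G. (if e \<in> R then -1 else 1) * inc G v e)"
  by (subst excess_eq_sum_inc) (auto simp: inc_reorient intro!: sum.cong)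

lemma excess_reorient_cong:
  assumes "finite (arcs G)" "R \<inter> arcs G = R' \<inter> arcs G"
  shows "excess (reorient G R) v = excess (reorient G R') v"
  unfolding excess_reorient_eq_sum[OF assms(1)] using assms(2) by (intro sum.cong) auto

lemma excess_reorient_complement:
  assumes "finite (arcs G)"
  shows "excess (reorient G (arcs G - R)) v = - excess (reorient G R) v"
  unfolding excess_reorient_eq_sum[OF assms] sum_negf[symmetric] by (intro sum.cong) auto

lemma excess_change_orientation:
  assumes "finite (arcs G)" "D = sym_diff R R' \<inter> arcs G"
  shows "excess (reorient G R') v = excess (reorient G R) v - 2 * excess (reorient G R\<lparr>arcs := D\<rparr>) v"
proof -
  have "excess (reorient G R') v = excess (reorient (reorient G R) D) v"
    unfolding reorient_reorient using assms by (intro excess_reorient_cong) auto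
  also have "\<dots> = excess (reorient G R) v - 2 * excess (reorient G R\<lparr>arcs := D\<rparr>) v"
    using assms by (intro excess_reorient) auto
  finally show ?thesis .
qed

lemma conserved_iff_sum_inc:
  fixes f :: "'e \<Rightarrow> 'g :: ring_1"
  assumes "finite (arcs G)"
  shows "conserved G f \<longleftrightarrow> (\<forall>v \<in> verts G. (\<Sum>e \<in> arcs G. of_int (inc G v e) * f e) = 0)"
proof -
  have "(\<Sum>e \<in> arcs G. of_int (inc G v e) * f e) = (\<Sum>e \<in> out_arcs G v. f e) - (\<Sum>e \<in> in_arcs G v. f e)" for v
  proof -
    have "arcs G \<inter> {e. tail G e = v} = out_arcs G v" "arcs G \<inter> {e. head G e = v} = in_arcs G v"
      by auto
    moreover have "of_int (inc G v e) * f e =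
        (if tail G e = v then f e else 0) - (if head G e = v then f e else 0)" for e
      by (simp add: inc_def)
    ultimately show ?thesis
      using assms by (simp add: sum_subtractf sum.If_cases)
  qed
  then show ?thesis by (simp add: conserved_def)
qed

text \<open>
  The function with value 1 along the orientation \<open>R\<close>. Over \<open>\<int>\<^sub>3\<close> every flow has this form;
  over the integers the flows with values \<open>\<plusminus>1\<close> do. Both are needed, hence the general ring.
\<close>

definition unit_flow :: "('v, 'e) pre_digraph \<Rightarrow> 'e set \<Rightarrow> 'e \<Rightarrow> 'g :: ring_1" where
  "unit_flow G R = (\<lambda>e \<in> arcs G. if e \<in> R then - 1 else 1)"

text \<open>
  The integers of absolute value less than 3 that are congruent to 1 modulo 3 are \<open>1\<close> and \<open>-2\<close>, so
  these are the functions with the values of a 3-flow that reduce to \<open>unit_flow G R\<close> modulo 3.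
\<close>

definition lift_flow :: "('v, 'e) pre_digraph \<Rightarrow> 'e set \<Rightarrow> 'e set \<Rightarrow> 'e \<Rightarrow> int" where
  "lift_flow G R F = (\<lambda>e \<in> arcs G. (if e \<in> R then - 1 else 1) * (if e \<in> F then - 2 else 1))"

lemma lift_flow_empty: "lift_flow G R {} = unit_flow G R"
  by (auto simp: lift_flow_def unit_flow_def)

lemma conserved_unit_flow:
  assumes "finite (arcs G)"
  shows "conserved G (unit_flow G R :: 'e \<Rightarrow> 'g :: ring_1) \<longleftrightarrow>
    (\<forall>v \<in> verts G. of_int (excess (reorient G R) v) = (0 :: 'g))"
proof -
  have "(\<Sum>e \<in> arcs G. of_int (inc G v e) * (unit_flow G R e :: 'g)) = of_int (excess (reorient G R) v)" for v
    unfolding excess_reorient_eq_sum[OF assms] of_int_sum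
    by (intro sum.cong) (auto simp: unit_flow_def)
  then show ?thesis by (simp add: conserved_iff_sum_inc[OF assms])
qed

text \<open>
  Since \<open>-2 = 1 - 3\<close>, the net outflow at \<open>v\<close> is the excess in \<open>G\<close> minus three times that in \<open>F\<close>.
\<close>

lemma conserved_lift_flow:
  assumes "finite (arcs G)" "F \<subseteq> arcs G"
  shows "conserved G (lift_flow G R F) \<longleftrightarrow>
    (\<forall>v \<in> verts G. excess (reorient G R) v = 3 * excess (reorient G R\<lparr>arcs := F\<rparr>) v)"
proof -
  have "(\<Sum>e \<in> arcs G. inc G v e * lift_flow G R F e) =
      excess (reorient G R) v - 3 * excess (reorient G R\<lparr>arcs := F\<rparr>) v" for v
  proof -
    have "finite F" using assms finite_subset by blast
    then have "excess (reorient G R\<lparr>arcs := F\<rparr>) v = (\<Sum>e \<in> F. (if e \<in> R then -1 else 1) * inc G v e)"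
      by (subst excess_restrict) (auto simp: inc_reorient intro!: sum.cong)
    also have "\<dots> = (\<Sum>e \<in> arcs G. if e \<in> F then (if e \<in> R then -1 else 1) * inc G v e else 0)"
      using assms by (simp add: sum.inter_restrict[symmetric] Int_absorb1)
    finally have eq: "excess (reorient G R\<lparr>arcs := F\<rparr>) v =
      (\<Sum>e \<in> arcs G. if e \<in> F then (if e \<in> R then -1 else 1) * inc G v e else 0)" .
    show ?thesis
      unfolding excess_reorient_eq_sum[OF assms(1)] eq sum_distrib_left sum_subtractf[symmetric]
      by (intro sum.cong) (auto simp: lift_flow_def)
  qed
  then show ?thesis using conserved_iff_sum_inc[OF assms(1), of "lift_flow G R F"] by simp
qed

lemma k_flow_lift_flow:
  assumes "finite (arcs G)" "F \<subseteq> arcs G"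
  shows "k_flow 3 G (lift_flow G R F) \<longleftrightarrow>
    (\<forall>v \<in> verts G. excess (reorient G R) v = 3 * excess (reorient G R\<lparr>arcs := F\<rparr>) v)"
  using conserved_lift_flow[OF assms] by (auto simp: k_flow_def lift_flow_def)

lemma k_flow_3_cases:
  assumes "k_flow 3 G f"
  obtains R F where "F \<subseteq> arcs G" "f = lift_flow G R F"
proof
  let ?F = "{e \<in> arcs G. f e \<in> {-2, 2}}"
  show "?F \<subseteq> arcs G" by auto
  show "f = lift_flow G {e \<in> arcs G. f e \<in> {-1, 2}} ?F"
  proof
    fix e
    have "f e \<in> {-2, -1, 1, 2}" if "e \<in> arcs G"
    proof -
      have "0 < \<bar>f e\<bar>" "\<bar>f e\<bar> < 3" using assms that by (auto simp: k_flow_def PiE_iff)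
      then have "f e = -2 \<or> f e = -1 \<or> f e = 1 \<or> f e = 2" by arith
      then show ?thesis by blast
    qed
    then consider "e \<notin> arcs G" | "e \<in> arcs G" "f e \<in> {-2, -1, 1, 2}" by blast
    then show "f e = lift_flow G {e \<in> arcs G. f e \<in> {-1, 2}} ?F e"
    proof cases
      case 1
      then show ?thesis using assms by (auto simp: k_flow_def lift_flow_def PiE_iff extensional_def)
    next
      case 2
      then show ?thesis by (auto simp: lift_flow_def)
    qed
  qed
qed

lemma of_int_3_eq_0_iff: "(of_int k :: 3) = 0 \<longleftrightarrow> 3 dvd k"
proof -
  have three: "(of_int 3 :: 3) = 0" by simp
  have "(of_int k :: 3) = of_int (3 * (k div 3) + k mod 3)" by simp
  also have "\<dots> = of_int (k mod 3)" unfolding of_int_add of_int_mult three by simp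
  finally have eq: "(of_int k :: 3) = of_int (k mod 3)" .
  have "k mod 3 = 0 \<or> k mod 3 = 1 \<or> k mod 3 = 2" by presburger
  then consider "k mod 3 = 0" | "k mod 3 = 1" | "k mod 3 = 2" by blast
  then show ?thesis by cases (simp_all add: eq dvd_eq_mod_eq_0)
qed

lemma nonzero_3_cases:
  fixes x :: 3
  assumes "x \<noteq> 0"
  shows "x = 1 \<or> x = - 1"
proof -
  have "card {0, 1, - 1 :: 3} = card (UNIV :: 3 set)" by simp
  then have "{0, 1, - 1 :: 3} = UNIV" by (intro card_subset_eq) auto
  then show ?thesis using assms by blast
qed

lemma A_flow_unit_flow:
  assumes "finite (arcs G)"
  shows "A_flow G (unit_flow G R :: 'e \<Rightarrow> 3) \<longleftrightarrow> (\<forall>v \<in> verts G. 3 dvd excess (reorient G R) v)"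
  using conserved_unit_flow[OF assms, where 'g = 3 and R = R]
  by (auto simp: A_flow_def of_int_3_eq_0_iff unit_flow_def)

lemma A_flow_3_eq_unit_flow:
  assumes "A_flow G (f :: 'e \<Rightarrow> 3)"
  shows "f = unit_flow G {e \<in> arcs G. f e = - 1}"
proof
  fix e
  show "f e = unit_flow G {e \<in> arcs G. f e = - 1} e"
  proof (cases "e \<in> arcs G")
    case True
    then have "f e \<noteq> 0" using assms by (auto simp: A_flow_def PiE_iff)
    with True show ?thesis using nonzero_3_cases[of "f e"] by (auto simp: unit_flow_def)
  next
    case False
    then show ?thesis using assms by (auto simp: A_flow_def unit_flow_def PiE_iff extensional_def)
  qed
qed

section \<open>Equivalence of flows\<close>

lemma equivalent_flows_sym:
  assumes "equivalent_flows Fl G f f'"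
  shows "equivalent_flows Fl G f' f"
proof -
  have "symp (\<lambda>f f'. Fl f \<and> Fl f' \<and> adjacent_flows G f f')"
    by (auto simp: symp_def adjacent_flows_def)
  from symp_rtranclp[OF this] assms show ?thesis
    by (auto simp: equivalent_flows_def symp_def)
qed

lemma equivalent_flows_step:
  assumes "cycle_in G C" "\<And>e. e \<in> arcs G - arcs C \<Longrightarrow> f e = f' e" "Fl f" "Fl f'" "equivalent_flows Fl G f' f''"
  shows "equivalent_flows Fl G f f''"
  using assms unfolding equivalent_flows_def adjacent_flows_def
  by (intro converse_rtranclp_into_rtranclp[of _ f f' f'']) auto

text \<open>
  The edges on which two balanced orientations differ are balanced in either of them. Reversing
  a directed cycle among these edges keeps the orientation balanced and leaves fewer
  differences.
\<close>

lemma balanced_unit_flows_equivalent: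
  fixes G :: "('v, 'e) pre_digraph" and Fl :: "('e \<Rightarrow> 'g :: ring_1) \<Rightarrow> bool"
  assumes G: "fin_digraph G" and Fl: "\<And>R. balanced (reorient G R) \<Longrightarrow> Fl (unit_flow G R)"
    and R': "balanced (reorient G R')" and R: "balanced (reorient G R)"
  shows "equivalent_flows Fl G (unit_flow G R) (unit_flow G R')"
  using R
proof (induction "card (sym_diff R R' \<inter> arcs G)" arbitrary: R rule: less_induct)
  case less
  interpret fin_digraph G by fact
  define D where "D = sym_diff R R' \<inter> arcs G"
  have fin: "finite D" by (simp add: D_def)
  show ?case
  proof (cases "D = {}")
    case True
    then have "unit_flow G R = (unit_flow G R' :: 'e \<Rightarrow> 'g)"
      by (auto simp: unit_flow_def D_def fun_eq_iff)
    then show ?thesis by (simp add: equivalent_flows_def)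
  next
    case False
    have "balanced (reorient G R\<lparr>arcs := D\<rparr>)"
      using excess_change_orientation[OF finite_arcs D_def] R' less.prems by (simp add: balanced_def)
    then obtain Z C where Z: "Z \<subseteq> D" "Z \<noteq> {}" "cycle_in G C" "arcs C = Z"
        "balanced (reorient G R\<lparr>arcs := Z\<rparr>)"
      using balanced_contains_cycle[OF G _ False, of R] by (auto simp: D_def)
    let ?R1 = "sym_diff R Z"
    have "Z = sym_diff R ?R1 \<inter> arcs G" using Z(1) by (auto simp: D_def)
    from excess_change_orientation[OF finite_arcs this]
    have R1: "balanced (reorient G ?R1)" using Z(5) less.prems by (simp add: balanced_def)
    have "sym_diff ?R1 R' \<inter> arcs G = D - Z" using Z(1) by (auto simp: D_def)
    moreover have "card (D - Z) < card D" using Z(1,2) fin by (intro psubset_card_mono) auto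
    ultimately have "equivalent_flows Fl G (unit_flow G ?R1) (unit_flow G R')"
      using less.hyps[OF _ R1] by (simp add: D_def)
    then show ?thesis
      using Z(4)
      by (intro equivalent_flows_step[where Fl = Fl, OF Z(3) _ Fl[OF less.prems] Fl[OF R1]])
        (auto simp: unit_flow_def)
  qed
qed

text \<open>
  When the orientation is balanced, conservation makes \<open>F\<close> balanced as well. Changing \<open>-2\<close> to \<open>1\<close>
  along a directed cycle in \<open>F\<close> keeps \<open>F\<close> balanced and therefore yields a 3-flow again.
\<close>

lemma lift_flow_equivalent_unit_flow:
  assumes G: "fin_digraph G" and R: "balanced (reorient G R)"
    and F: "F \<subseteq> arcs G" "k_flow 3 G (lift_flow G R F)"
  shows "equivalent_flows (k_flow 3 G) G (lift_flow G R F) (unit_flow G R)"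
  using F
proof (induction "card F" arbitrary: F rule: less_induct)
  case less
  interpret fin_digraph G by fact
  have fin: "finite F" using less.prems(1) by (rule finite_subset) simp
  show ?case
  proof (cases "F = {}")
    case True
    then show ?thesis by (simp add: lift_flow_empty equivalent_flows_def)
  next
    case False
    have bal: "balanced (reorient G R\<lparr>arcs := F\<rparr>)"
      using less.prems R by (simp add: k_flow_lift_flow balanced_def)
    then obtain Z C where Z: "Z \<subseteq> F" "Z \<noteq> {}" "cycle_in G C" "arcs C = Z"
        "balanced (reorient G R\<lparr>arcs := Z\<rparr>)"
      using balanced_contains_cycle[OF G less.prems(1) False] by blast
    have fl: "k_flow 3 G (lift_flow G R (F - Z))"
      using less.prems(1) R bal Z(5) excess_restrict_diff[OF fin Z(1), of "reorient G R"]
      by (subst k_flow_lift_flow) (auto simp: balanced_def)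
    have "card (F - Z) < card F" using Z(1,2) fin by (intro psubset_card_mono) auto
    then have "equivalent_flows (k_flow 3 G) G (lift_flow G R (F - Z)) (unit_flow G R)"
      using less.hyps[OF _ _ fl] less.prems(1) by blast
    then show ?thesis
      using Z(4)
      by (intro equivalent_flows_step[where Fl = "k_flow 3 G", OF Z(3) _ less.prems(2) fl])
        (auto simp: lift_flow_def)
  qed
qed

text \<open>
  Every vertex is an end of at most two edges of the cycle, counted with multiplicity: its degree
  there is 2 on the cycle and 0 off it.
\<close>

lemma abs_excess_restrict_cycle:
  assumes G: "fin_digraph G" and C: "cycle_in G C" and D: "D \<subseteq> arcs C"
  shows "\<bar>excess (reorient G R\<lparr>arcs := D\<rparr>) v\<bar> \<le> 2"
proof -
  interpret fin_digraph G by fact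
  have C': "arcs C \<subseteq> arcs G" "tail C = tail G" "head C = head G" "wf_digraph C"
    using C by (auto simp: cycle_in_def subgraph_def compatible_def)
  then interpret C: wf_digraph C by simp
  have fin: "finite (arcs C)" "finite D" using C'(1) D finite_arcs finite_subset by metis+
  have "\<bar>excess (reorient G R\<lparr>arcs := D\<rparr>) v\<bar> \<le> (\<Sum>e \<in> D. \<bar>inc (reorient G R) v e\<bar>)"
    using fin by (simp add: excess_restrict)
  also have "\<dots> \<le> (\<Sum>e \<in> D. of_bool (tail C e = v) + of_bool (head C e = v))"
    by (intro sum_mono) (auto simp: inc_def C')
  also have "\<dots> \<le> (\<Sum>e \<in> arcs C. of_bool (tail C e = v) + of_bool (head C e = v))"
    using fin D by (intro sum_mono2) auto
  also have "\<dots> = int (degree C v)" using fin by (simp add: degree_eq_sum)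
  also have "\<dots> \<le> 2"
  proof (cases "v \<in> verts C")
    case True
    then show ?thesis using C by (simp add: cycle_in_def)
  next
    case False
    then have "in_arcs C v = {}" "out_arcs C v = {}" by auto
    then show ?thesis by (simp add: degree_def in_degree_def out_degree_def)
  qed
  finally show ?thesis .
qed

text \<open>
  Reversing the set \<open>D\<close> of edges where adjacent flows have different directions changes the excess by
  twice the excess in \<open>D\<close>. The latter is at most 2 in absolute value because \<open>D\<close> lies in a cycle, and
  it is divisible by 3, so it is 0. The predicate \<open>N\<close> decides from the value of a flow whether the
  edge is reversed; this covers 3-flows and \<open>\<int>\<^sub>3\<close>-flows at once.
\<close>

lemma excess_invariant:
  fixes G :: "('v, 'e) pre_digraph" and N :: "'g \<Rightarrow> bool"
  assumes G: "fin_digraph G" and v: "v \<in> verts G"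
    and Fl: "\<And>f. Fl f \<Longrightarrow> 3 dvd excess (reorient G {e \<in> arcs G. N (f e)}) v"
    and eq: "equivalent_flows Fl G f f'"
  shows "excess (reorient G {e \<in> arcs G. N (f e)}) v = excess (reorient G {e \<in> arcs G. N (f' e)}) v"
  using eq unfolding equivalent_flows_def
proof (induction rule: rtranclp_induct)
  case base
  then show ?case by simp
next
  case (step g h)
  interpret fin_digraph G by fact
  let ?R = "\<lambda>f. {e \<in> arcs G. N (f e)}"
  define D where "D = sym_diff (?R g) (?R h) \<inter> arcs G"
  obtain C where C: "cycle_in G C" "\<And>e. e \<in> arcs G - arcs C \<Longrightarrow> g e = h e"
    using step by (auto simp: adjacent_flows_def)
  have "D \<subseteq> arcs C"
  proof
    fix e assume "e \<in> D"
    then show "e \<in> arcs C" using C(2)[of e] by (cases "e \<in> arcs C") (auto simp: D_def)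
  qed
  from abs_excess_restrict_cycle[OF G C(1) this]
  have "\<bar>excess (reorient G (?R g)\<lparr>arcs := D\<rparr>) v\<bar> \<le> 2" .
  moreover note excess_change_orientation[OF finite_arcs D_def, of v]
  moreover have "b = a" if "\<bar>c\<bar> \<le> 2" "b = a - 2 * c" "3 dvd a" "3 dvd b" for a b c :: int
    using that by presburger
  ultimately have "excess (reorient G (?R h)) v = excess (reorient G (?R g)) v"
    using Fl[of g] Fl[of h] step(2) by blast
  with step.IH show ?case by simp
qed

section \<open>Edge-disjoint paths and edge cuts\<close>

lemma path_crosses_edge_cut:
  assumes "path_between G w x p" "w \<in> T" "x \<notin> T"
  obtains e where "e \<in> set (snd p)" "e \<in> edge_cut G T"
proof -
  obtain vs es where p: "p = (vs, es)" by (cases p)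
  have path: "length vs = Suc (length es)" "hd vs = w" "last vs = x" "set es \<subseteq> arcs G"
    "\<And>i. i < length es \<Longrightarrow> {tail G (es ! i), head G (es ! i)} = {vs ! i, vs ! Suc i}"
    using assms(1) by (simp_all add: path_between_def p)
  have "vs \<noteq> []" using path(1) by auto
  then have ends: "vs ! 0 = w" "vs ! length es = x"
    using path(1-3) by (simp_all add: hd_conv_nth last_conv_nth)
  obtain i where i: "i < length es" "vs ! i \<in> T" "vs ! Suc i \<notin> T"
  proof (rule ccontr)
    assume "\<not> thesis"
    then have step: "vs ! Suc i \<in> T" if "i < length es" "vs ! i \<in> T" for i
      using that \<open>\<And>i. \<lbrakk>i < length es; vs ! i \<in> T; vs ! Suc i \<notin> T\<rbrakk> \<Longrightarrow> thesis\<close> by blast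
    have "i \<le> length es \<Longrightarrow> vs ! i \<in> T" for i
      by (induction i) (use step ends assms(2) in auto)
    then show False using ends(2) assms(3) by auto
  qed
  have "es ! i \<in> edge_cut G T"
    using path(4) path(5)[OF i(1)] i by (auto simp: edge_cut_def doubleton_eq_iff)
  then show thesis using that[of "es ! i"] i(1) by (simp add: p)
qed

lemma card_le_card_edge_cut:
  assumes "finite (arcs G)" "\<And>p. p \<in> P \<Longrightarrow> path_between G w x p" "edge_disjoint P" "w \<in> T" "x \<notin> T"
  shows "card P \<le> card (edge_cut G T)"
proof -
  have "\<forall>p \<in> P. \<exists>e. e \<in> set (snd p) \<and> e \<in> edge_cut G T"
    using path_crosses_edge_cut[OF assms(2) assms(4,5)] by metis
  then obtain c where c: "\<And>p. p \<in> P \<Longrightarrow> c p \<in> set (snd p) \<and> c p \<in> edge_cut G T" by metis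
  have "inj_on c P"
  proof (rule inj_onI, rule ccontr)
    fix p q assume "p \<in> P" "q \<in> P" "c p = c q" "p \<noteq> q"
    then have "disjnt (set (snd p)) (set (snd q))"
      using assms(3) by (auto simp: edge_disjoint_def pairwise_def)
    with c[OF \<open>p \<in> P\<close>] c[OF \<open>q \<in> P\<close>] \<open>c p = c q\<close> show False by (auto simp: disjnt_iff)
  qed
  moreover have "c ` P \<subseteq> edge_cut G T" using c by blast
  moreover have "finite (edge_cut G T)" using assms(1) by (simp add: edge_cut_def)
  ultimately show ?thesis by (rule card_inj_on_le)
qed

lemma apath_path_between:
  assumes G: "fin_digraph G" and p: "pre_digraph.apath (reorient G R) w p x"
  shows "path_between G w x (pre_digraph.awalk_verts (reorient G R) w p, p)"
proof -
  let ?K = "reorient G R"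
  interpret K: fin_digraph ?K using G by (rule fin_digraph_reorient)
  have aw: "K.awalk w p x" and dist: "distinct (K.awalk_verts w p)"
    using p by (auto simp: K.apath_def)
  have cas: "K.cas w p x" and sub: "set p \<subseteq> arcs ?K"
    using aw by (auto simp only: K.awalk_def)
  have verts: "set (K.awalk_verts w p) \<subseteq> verts ?K"
    using K.awalkE[OF aw] by metis
  have "{tail G (p ! i), head G (p ! i)} = {K.awalk_verts w p ! i, K.awalk_verts w p ! Suc i}"
    if i: "i < length p" for i
  proof -
    have "p \<noteq> []" using i by auto
    have "K.awalk_verts w p ! i = tail ?K (p ! i)"
      using i \<open>p \<noteq> []\<close> K.awalk_verts_conv[of w p]
      by (simp add: nth_append del: reorient_simps(3,4))
    moreover have "K.awalk_verts w p ! Suc i = head ?K (p ! i)"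
      using i \<open>p \<noteq> []\<close> K.awalk_verts_conv'[OF cas] by (simp del: reorient_simps(3,4))
    ultimately show ?thesis by auto
  qed
  then show ?thesis
    using dist verts sub K.length_awalk_verts[of w p] K.awhd_if_cas[OF cas] K.awlast_if_cas[OF cas]
    by (simp add: path_between_def)
qed

text \<open>
  In a graph with even degrees every excess is even, so 6 is the first excess above 4 that occurs.
\<close>

lemma five_paths_from_excess_6:
  assumes G: "fin_digraph G" and wx: "w \<in> verts G" "w \<noteq> x"
    and R: "excess (reorient G R) w = 6" "\<And>v. v \<in> verts G - {w, x} \<Longrightarrow> excess (reorient G R) v = 0"
  obtains P where "\<And>p. p \<in> P \<Longrightarrow> path_between G w x p" "edge_disjoint P" "card P = 5"
proof -
  let ?K = "reorient G R"
  have "\<exists>Q. finite Q \<and> card Q = 5 \<and> (\<forall>q \<in> Q. pre_digraph.apath ?K w q x) \<and>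
      pairwise (\<lambda>p q. disjnt (set p) (set q)) Q"
  proof (rule arc_disjoint_apaths)
    show "excess ?K v \<ge> 0" if "v \<in> verts ?K" "v \<noteq> x" for v
      using that R by (cases "v = w") auto
  qed (use assms fin_digraph_reorient in auto)
  then obtain Q where Q: "card Q = 5" "\<And>q. q \<in> Q \<Longrightarrow> pre_digraph.apath ?K w q x"
      "pairwise (\<lambda>p q. disjnt (set p) (set q)) Q"
    by blast
  let ?pair = "\<lambda>p. (pre_digraph.awalk_verts ?K w p, p)"
  show thesis
  proof (rule that[of "?pair ` Q"])
    show "path_between G w x p" if "p \<in> ?pair ` Q" for p
      using that apath_path_between[OF G Q(2)] by auto
    show "edge_disjoint (?pair ` Q)"
      using Q(3) by (auto simp: edge_disjoint_def pairwise_def)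
    show "card (?pair ` Q) = 5"
      using Q(1) by (subst card_image) (auto simp: inj_on_def)
  qed
qed

section \<open>Small cuts between all pairs of vertices\<close>

text \<open>
  If \<open>X\<close> and \<open>Y\<close> overlap, replacing \<open>X\<close> by \<open>X - Y\<close> does not change the union and lowers the total
  size.
\<close>

lemma disjoint_cover:
  assumes "finite \<F>" "\<And>X. X \<in> \<F> \<Longrightarrow> finite X \<and> Q X"
    and "\<And>X Y. Q X \<Longrightarrow> Q Y \<Longrightarrow> Q (X - Y) \<or> Q (Y - X)"
  shows "\<exists>\<F>'. finite \<F>' \<and> (\<forall>X \<in> \<F>'. finite X \<and> Q X) \<and> disjoint \<F>' \<and> \<Union>\<F>' = \<Union>\<F>"
  using assms(1,2)
proof (induction "\<Sum>X \<in> \<F>. card X" arbitrary: \<F> rule: less_induct)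
  case less
  show ?case
  proof (cases "disjoint \<F>")
    case True
    then show ?thesis using less.prems by blast
  next
    case False
    then obtain X0 Y0 where XY0: "X0 \<in> \<F>" "Y0 \<in> \<F>" "X0 \<noteq> Y0" "X0 \<inter> Y0 \<noteq> {}"
      unfolding pairwise_def disjnt_def by blast
    then obtain X Y where XY: "X \<in> \<F>" "Y \<in> \<F>" "X \<noteq> Y" "X \<inter> Y \<noteq> {}" "Q (X - Y)"
      using assms(3)[of X0 Y0] less.prems(2) by blast
    let ?F = "insert (X - Y) (\<F> - {X})"
    have "(\<Sum>Z \<in> ?F. card Z) \<le> card (X - Y) + (\<Sum>Z \<in> \<F> - {X}. card Z)"
      using less.prems(1) by (cases "X - Y \<in> \<F> - {X}") (simp_all add: insert_absorb)
    also have "\<dots> < card X + (\<Sum>Z \<in> \<F> - {X}. card Z)"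
      using less.prems(2)[OF XY(1)] XY(4) by (auto intro!: psubset_card_mono)
    also have "\<dots> = (\<Sum>Z \<in> \<F>. card Z)"
      using less.prems(1) XY(1) by (simp add: sum.remove)
    finally have "\<exists>\<F>'. finite \<F>' \<and> (\<forall>X \<in> \<F>'. finite X \<and> Q X) \<and> disjoint \<F>' \<and> \<Union>\<F>' = \<Union>?F"
      using less.prems XY(1,5) by (intro less.hyps) auto
    moreover have "\<Union>?F = \<Union>\<F>" using XY(1-3) by auto
    ultimately show ?thesis by metis
  qed
qed

text \<open>
  An edge between \<open>X - Y\<close> and \<open>Y - X\<close> is counted twice on both sides; any other edge counted
  on the left is counted once there and belongs to the boundary of \<open>X\<close> or of \<open>Y\<close>.
\<close>

lemma card_edge_cut_posimodular:
  assumes "finite (arcs G)"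
  shows "card (edge_cut G (X - Y)) + card (edge_cut G (Y - X)) \<le> card (edge_cut G X) + card (edge_cut G Y)"
proof -
  have "int (card (edge_cut G (X - Y))) + int (card (edge_cut G (Y - X))) \<le> int (card (edge_cut G X)) + int (card (edge_cut G Y))"
    unfolding card_edge_cut_eq_sum[OF assms] sum.distrib[symmetric]
    by (intro sum_mono) (auto simp: of_bool_def)
  then show ?thesis by linarith
qed

text \<open>
  A set with at most 4 boundary edges has an excess that is a multiple of 6 and at most 4 in absolute
  value, hence 0. For each \<open>v\<close> such sets cover all other vertices. If two of them overlap, one of
  the two differences again has at most 4 boundary edges, by posimodularity, so the cover can be
  taken to be disjoint. The excess of the complement of \<open>v\<close> is then 0.
\<close>

lemma balanced_if_small_cuts:
  assumes G: "fin_digraph G" and six: "\<And>v. v \<in> verts G \<Longrightarrow> 6 dvd excess G v"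
    and cuts: "\<And>w x. w \<in> verts G \<Longrightarrow> x \<in> verts G \<Longrightarrow> w \<noteq> x \<Longrightarrow>
      \<exists>T. T \<subseteq> verts G \<and> w \<in> T \<and> x \<notin> T \<and> card (edge_cut G T) \<le> 4"
  shows "balanced G"
  unfolding balanced_def
proof
  fix v assume v: "v \<in> verts G"
  interpret fin_digraph G by fact
  have zero: "(\<Sum>y \<in> X. excess G y) = 0" if "X \<subseteq> verts G" "card (edge_cut G X) \<le> 4" for X
  proof -
    have "6 dvd (\<Sum>y \<in> X. excess G y)" using six that(1) by (intro dvd_sum) blast
    moreover have "\<bar>\<Sum>y \<in> X. excess G y\<bar> \<le> 4"
      using abs_sum_excess_le_card_edge_cut[OF finite_arcs finite_subset[OF that(1) finite_verts]] that(2)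
      by linarith
    ultimately show ?thesis using zdvd_imp_le[of 6 "\<bar>\<Sum>y \<in> X. excess G y\<bar>"] by force
  qed
  let ?Q = "\<lambda>X. X \<subseteq> verts G - {v} \<and> card (edge_cut G X) \<le> 4"
  have "\<exists>\<F>'. finite \<F>' \<and> (\<forall>X \<in> \<F>'. finite X \<and> ?Q X) \<and> disjoint \<F>' \<and> \<Union>\<F>' = \<Union>{X. ?Q X}"
  proof (rule disjoint_cover)
    show "finite {X. ?Q X}" by (rule finite_subset[of _ "Pow (verts G)"]) auto
    show "finite X \<and> ?Q X" if "X \<in> {X. ?Q X}" for X
      using that finite_subset[of X "verts G"] by auto
    show "?Q (X - Y) \<or> ?Q (Y - X)" if "?Q X" "?Q Y" for X Y
    proof -
      have "card (edge_cut G (X - Y)) \<le> 4 \<or> card (edge_cut G (Y - X)) \<le> 4"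
        using card_edge_cut_posimodular[of G X Y] that by auto
      then show ?thesis using that by blast
    qed
  qed
  then obtain \<F> where F': "finite \<F> \<and> (\<forall>X \<in> \<F>. finite X \<and> ?Q X) \<and> disjoint \<F> \<and> \<Union>\<F> = \<Union>{X. ?Q X}"
    by (rule exE)
  then have F: "finite \<F>" "\<And>X. X \<in> \<F> \<Longrightarrow> finite X \<and> ?Q X" "disjoint \<F>" "\<Union>\<F> = \<Union>{X. ?Q X}"
    by (simp_all only:)
  have "\<Union>{X. ?Q X} = verts G - {v}"
  proof
    show "verts G - {v} \<subseteq> \<Union>{X. ?Q X}"
    proof
      fix x assume x: "x \<in> verts G - {v}"
      then obtain T where T: "T \<subseteq> verts G" "v \<in> T" "x \<notin> T" "card (edge_cut G T) \<le> 4"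
        using cuts[OF v, of x] by auto
      have "edge_cut G (verts G - T) = edge_cut G T" by (auto simp: edge_cut_def)
      then show "x \<in> \<Union>{X. ?Q X}" using T x by (intro UnionI[of "verts G - T"]) auto
    qed
  qed auto
  then have "(\<Sum>y \<in> verts G - {v}. excess G y) = (\<Sum>y \<in> \<Union>\<F>. excess G y)"
    using F(4) by simp
  also have "\<dots> = (\<Sum>X \<in> \<F>. \<Sum>y \<in> X. excess G y)"
    using sum.Union_disjoint[of \<F> "excess G"] F(2,3) by (simp add: pairwise_def disjnt_def)
  also have "\<dots> = 0"
    using F(2) by (intro sum.neutral ballI zero) auto
  finally show "excess G v = 0"
    using sum_excess_verts[OF G] sum.remove[OF finite_verts v, of "excess G"] by simp
qed

section \<open>The equivalence\<close>

abbreviation (input) at_most_4_paths :: "('v, 'e) pre_digraph \<Rightarrow> bool" where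
  "at_most_4_paths G \<equiv> \<forall>w \<in> verts G. \<forall>x \<in> verts G. w \<noteq> x \<longrightarrow>
    (\<forall>P. (\<forall>p \<in> P. path_between G w x p) \<and> edge_disjoint P \<longrightarrow> finite P \<and> card P \<le> 4)"

text \<open>
  The negative of a flow belongs to the opposite orientation, so by invariance its excess is equal to
  its own negative.
\<close>

lemma k_flow_connected_imp_balanced:
  assumes G: "fin_digraph G" and conn: "k_flow_connected 3 G"
    and F: "F \<subseteq> arcs G" "k_flow 3 G (lift_flow G R F)"
  shows "balanced (reorient G R)"
  unfolding balanced_def
proof
  fix v assume "v \<in> verts (reorient G R)"
  then have v: "v \<in> verts G" by simp
  interpret fin_digraph G by fact
  \<comment> \<open>The values of a 3-flow that are congruent to \<open>-1\<close> modulo 3.\<close>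
  let ?N = "\<lambda>z :: int. z \<in> {-1, 2}"
  have rev: "{e \<in> arcs G. ?N (lift_flow G R' F' e)} = R' \<inter> arcs G" for R' F'
    by (auto simp: lift_flow_def)
  have dvd: "3 dvd excess (reorient G {e \<in> arcs G. ?N (f e)}) v" if "k_flow 3 G f" for f
  proof -
    obtain R' F' where f: "F' \<subseteq> arcs G" "f = lift_flow G R' F'"
      using k_flow_3_cases[OF \<open>k_flow 3 G f\<close>] .
    have "excess (reorient G {e \<in> arcs G. ?N (f e)}) v = excess (reorient G R') v"
      unfolding f(2) rev by (intro excess_reorient_cong) auto
    then show ?thesis using \<open>k_flow 3 G f\<close> f v by (simp add: k_flow_lift_flow)
  qed
  have "k_flow 3 G (lift_flow G (arcs G - R) F)"
  proof -
    have "finite F" using F(1) by (rule finite_subset) simp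
    then have "excess (reorient G (arcs G - R)\<lparr>arcs := F\<rparr>) y = - excess (reorient G R\<lparr>arcs := F\<rparr>) y" for y
      using F(1) by (auto simp: excess_restrict inc_reorient sum_negf[symmetric] intro!: sum.cong)
    then show ?thesis
      using F by (simp add: k_flow_lift_flow excess_reorient_complement)
  qed
  then have "equivalent_flows (k_flow 3 G) G (lift_flow G R F) (lift_flow G (arcs G - R) F)"
    using conn F by (auto simp: k_flow_connected_def pairwise_equivalent_def)
  from excess_invariant[where N = ?N, OF G v dvd this]
  have "excess (reorient G (R \<inter> arcs G)) v = excess (reorient G ((arcs G - R) \<inter> arcs G)) v"
    by (simp only: rev)
  moreover have "excess (reorient G (R \<inter> arcs G)) v = excess (reorient G R) v"
    by (intro excess_reorient_cong) auto
  moreover have "(arcs G - R) \<inter> arcs G = arcs G - R" by auto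
  ultimately show "excess (reorient G R) v = 0"
    using excess_reorient_complement[OF finite_arcs, of R v] by simp
qed

lemma A_flow_connected_imp_balanced:
  fixes G :: "('v, 'e) pre_digraph"
  assumes G: "fin_digraph G" and conn: "A_flow_connected TYPE(3) G"
    and dvd: "\<And>v. v \<in> verts G \<Longrightarrow> 3 dvd excess (reorient G R) v"
  shows "balanced (reorient G R)"
  unfolding balanced_def
proof
  fix v assume "v \<in> verts (reorient G R)"
  then have v: "v \<in> verts G" by simp
  interpret fin_digraph G by fact
  let ?N = "\<lambda>z :: 3. z = - 1"
  have rev: "{e \<in> arcs G. ?N (unit_flow G R' e)} = R' \<inter> arcs G" for R'
    by (auto simp: unit_flow_def)
  have dvd3: "3 dvd excess (reorient G {e \<in> arcs G. ?N (f e)}) v" if "A_flow G f" for f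
    using that v A_flow_3_eq_unit_flow[OF that] A_flow_unit_flow[OF finite_arcs] by metis
  have "A_flow G (unit_flow G R :: 'e \<Rightarrow> 3)" "A_flow G (unit_flow G (arcs G - R) :: 'e \<Rightarrow> 3)"
    using dvd by (simp_all add: A_flow_unit_flow excess_reorient_complement)
  then have "equivalent_flows (A_flow G) G (unit_flow G R :: 'e \<Rightarrow> 3) (unit_flow G (arcs G - R))"
    using conn by (auto simp: A_flow_connected_def pairwise_equivalent_def)
  from excess_invariant[where N = ?N, OF G v dvd3 this]
  have "excess (reorient G (R \<inter> arcs G)) v = excess (reorient G ((arcs G - R) \<inter> arcs G)) v"
    by (simp only: rev)
  moreover have "excess (reorient G (R \<inter> arcs G)) v = excess (reorient G R) v"
    by (intro excess_reorient_cong) auto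
  moreover have "(arcs G - R) \<inter> arcs G = arcs G - R" by auto
  ultimately show "excess (reorient G R) v = 0"
    using excess_reorient_complement[OF finite_arcs, of R v] by simp
qed

lemma A_flow_connected_imp_k_flow_connected:
  assumes G: "fin_digraph G" and conn: "A_flow_connected TYPE(3) G"
  shows "k_flow_connected 3 G"
  unfolding k_flow_connected_def pairwise_equivalent_def
proof (intro allI impI)
  interpret fin_digraph G by fact
  fix f f' assume f: "k_flow 3 G f" and f': "k_flow 3 G f'"
  have to_unit: "\<exists>R. balanced (reorient G R) \<and> equivalent_flows (k_flow 3 G) G g (unit_flow G R)"
    if g: "k_flow 3 G g" for g
  proof -
    obtain R F where F: "F \<subseteq> arcs G" and g_eq: "g = lift_flow G R F"
      using k_flow_3_cases[OF g] .
    have "\<And>v. v \<in> verts G \<Longrightarrow> 3 dvd excess (reorient G R) v"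
      using g F by (simp add: g_eq k_flow_lift_flow)
    then have R: "balanced (reorient G R)" by (rule A_flow_connected_imp_balanced[OF G conn])
    with lift_flow_equivalent_unit_flow[OF G R F] g g_eq show ?thesis by auto
  qed
  obtain R where R: "balanced (reorient G R)" "equivalent_flows (k_flow 3 G) G f (unit_flow G R)"
    using to_unit[OF f] by blast
  obtain R' where R': "balanced (reorient G R')" "equivalent_flows (k_flow 3 G) G f' (unit_flow G R')"
    using to_unit[OF f'] by blast
  have "k_flow 3 G (unit_flow G S)" if "balanced (reorient G S)" for S
    using that excess_restrict[of "{}" "reorient G S"]
    by (simp add: k_flow_lift_flow balanced_def flip: lift_flow_empty)
  then have "equivalent_flows (k_flow 3 G) G (unit_flow G R) (unit_flow G R')"
    by (intro balanced_unit_flows_equivalent[OF G _ R'(1) R(1)])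
  with R(2) equivalent_flows_sym[OF R'(2)] show "equivalent_flows (k_flow 3 G) G f f'"
    by (simp add: equivalent_flows_def)
qed

lemma at_most_4_paths_imp_A_flow_connected:
  fixes G :: "('v, 'e) pre_digraph"
  assumes G: "fin_digraph G" and eul: "eulerian_graph G" and few: "at_most_4_paths G"
  shows "A_flow_connected TYPE(3) G"
  unfolding A_flow_connected_def pairwise_equivalent_def
proof (intro allI impI)
  interpret fin_digraph G by fact
  fix f f' :: "'e \<Rightarrow> 3" assume f: "A_flow G f" and f': "A_flow G f'"
  have small: "\<exists>T. T \<subseteq> verts G \<and> w \<in> T \<and> x \<notin> T \<and> card (edge_cut G T) \<le> 4"
    if wx: "w \<in> verts G" "x \<in> verts G" "w \<noteq> x" for w x
  proof (rule ccontr)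
    assume "\<not> ?thesis"
    then have "card (edge_cut G T) > 4" if "T \<subseteq> verts G" "w \<in> T" "x \<notin> T" for T
      using that by (meson not_le)
    from orientation_excess_6[OF G eul wx this]
    obtain R where "excess (reorient G R) w = 6" "\<And>v. v \<in> verts G - {w, x} \<Longrightarrow> excess (reorient G R) v = 0"
      by blast
    then obtain P where P: "\<And>p. p \<in> P \<Longrightarrow> path_between G w x p" "edge_disjoint P" "card P = 5"
      using five_paths_from_excess_6[OF G wx(1,3)] by metis
    then have "card P \<le> 4" using few wx by blast
    with P(3) show False by simp
  qed
  have bal: "balanced (reorient G R)" if "A_flow G (unit_flow G R :: 'e \<Rightarrow> 3)" for R
  proof (rule balanced_if_small_cuts)
    show "fin_digraph (reorient G R)" using G by (rule fin_digraph_reorient)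
    fix v assume "v \<in> verts (reorient G R)"
    then have v: "v \<in> verts G" by simp
    have "3 dvd excess (reorient G R) v" using that v by (simp add: A_flow_unit_flow)
    moreover have "even (excess (reorient G R) v)"
      using eul v by (simp add: even_excess_iff_even_degree degree_reorient eulerian_graph_def)
    ultimately show "6 dvd excess (reorient G R) v" by presburger
  qed (use small in auto)
  obtain R R' where R: "f = unit_flow G R" "f' = unit_flow G R'"
    using A_flow_3_eq_unit_flow[OF f] A_flow_3_eq_unit_flow[OF f'] by blast
  have "A_flow G (unit_flow G S :: 'e \<Rightarrow> 3)" if "balanced (reorient G S)" for S
    using that by (simp add: A_flow_unit_flow balanced_def)
  then show "equivalent_flows (A_flow G) G f f'"
    unfolding R using f f' R bal by (intro balanced_unit_flows_equivalent[OF G]) auto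
qed

lemma k_flow_connected_imp_eulerian:
  assumes G: "fin_digraph G" and conn: "k_flow_connected 3 G" and f: "k_flow 3 G f"
  shows "eulerian_graph G"
proof -
  interpret fin_digraph G by fact
  obtain R F where "F \<subseteq> arcs G" "f = lift_flow G R F"
    using k_flow_3_cases[OF f] .
  then have "balanced (reorient G R)" using k_flow_connected_imp_balanced[OF G conn] f by blast
  then have "even (excess (reorient G R) v)" if "v \<in> verts G" for v
    using that by (simp add: balanced_def)
  then show ?thesis
    by (simp add: even_excess_iff_even_degree degree_reorient eulerian_graph_def)
qed

text \<open>
  More than four paths would give an orientation with excess 6 at \<open>w\<close> and \<open>-6\<close> at \<open>x\<close>. The value \<open>-2\<close>
  on two arc-disjoint \<open>w,x\<close>-paths and \<open>1\<close> elsewhere is conserved, since \<open>6 = 3 * 2\<close>, so this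
  unbalanced orientation comes from a 3-flow.
\<close>

lemma k_flow_connected_imp_at_most_4_paths:
  assumes G: "fin_digraph G" and conn: "k_flow_connected 3 G" and eul: "eulerian_graph G"
  shows "at_most_4_paths G"
proof (rule ccontr)
  interpret fin_digraph G by fact
  assume "\<not> at_most_4_paths G"
  then obtain w x P where wx: "w \<in> verts G" "x \<in> verts G" "w \<noteq> x"
    and P: "\<forall>p \<in> P. path_between G w x p" "edge_disjoint P" "\<not> (finite P \<and> card P \<le> 4)"
    by blast
  obtain P' where P': "P' \<subseteq> P" "card P' = 5"
  proof (cases "finite P")
    case True
    then show thesis using that P(3) obtain_subset_with_card_n[of 5 P] by auto
  next
    case False
    then show thesis using that infinite_arbitrarily_large[of P 5] by blast
  qed
  have "edge_disjoint P'"
    using P(2) P'(1) unfolding edge_disjoint_def by (rule pairwise_subset)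
  moreover have "\<And>p. p \<in> P' \<Longrightarrow> path_between G w x p" using P(1) P'(1) by blast
  ultimately have "card (edge_cut G T) > 4" if "w \<in> T" "x \<notin> T" for T
    using card_le_card_edge_cut[OF finite_arcs, of P' w x T] P'(2) that by simp
  then obtain R where R: "excess (reorient G R) w = 6"
    "\<And>v. v \<in> verts G - {w, x} \<Longrightarrow> excess (reorient G R) v = 0"
    using orientation_excess_6[OF G eul wx] by blast
  let ?K = "reorient G R"
  have K: "fin_digraph ?K" using G by (rule fin_digraph_reorient)
  then interpret K: fin_digraph ?K .
  have "\<exists>Q. finite Q \<and> card Q = 2 \<and> (\<forall>q \<in> Q. K.apath w q x) \<and>
      pairwise (\<lambda>p q. disjnt (set p) (set q)) Q"
  proof (rule arc_disjoint_apaths)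
    show "excess ?K v \<ge> 0" if "v \<in> verts ?K" "v \<noteq> x" for v
      using that R by (cases "v = w") auto
  qed (use R wx K in auto)
  then obtain p q where pq: "K.apath w p x" "K.apath w q x" "set p \<inter> set q = {}"
    unfolding card_2_iff by (auto simp: pairwise_def disjnt_def)
  let ?F = "set p \<union> set q"
  have F: "?F \<subseteq> arcs G"
    using pq by (auto simp: K.apath_def K.awalk_def)
  have exF: "excess (?K\<lparr>arcs := ?F\<rparr>) v = 2 * (of_bool (v = w) - of_bool (v = x))" for v
  proof -
    have "excess (?K\<lparr>arcs := ?F\<rparr>) v = excess (?K\<lparr>arcs := set p\<rparr>) v + excess (?K\<lparr>arcs := set q\<rparr>) v"
      using pq(3) by (simp add: excess_restrict sum.union_disjoint)
    then show ?thesis using excess_apath[OF K] pq(1,2) by simp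
  qed
  have "(\<Sum>v \<in> verts G. excess ?K v) = (\<Sum>v \<in> {w, x}. excess ?K v)"
    using wx R(2) by (intro sum.mono_neutral_right) auto
  then have "excess ?K x = - 6" using sum_excess_verts[OF K] wx R(1) by simp
  then have "excess ?K v = 3 * excess (?K\<lparr>arcs := ?F\<rparr>) v" if "v \<in> verts G" for v
    using that R wx by (cases "v = w"; cases "v = x") (auto simp: exF)
  then have "k_flow 3 G (lift_flow G R ?F)" using F by (simp add: k_flow_lift_flow)
  then have "balanced ?K" by (rule k_flow_connected_imp_balanced[OF G conn F])
  then show False using R(1) wx(1) by (simp add: balanced_def)
qed

theorem theorem2p1:
  fixes G :: "('v, 'e) pre_digraph"
  assumes "fin_digraph G"
    and "\<exists>f. k_flow 3 G f"
  shows "(k_flow_connected 3 G \<longleftrightarrow> A_flow_connected TYPE(3) G) \<and>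
    (A_flow_connected TYPE(3) G \<longleftrightarrow>
      eulerian_graph G \<and>
      (\<forall>w \<in> verts G. \<forall>x \<in> verts G. w \<noteq> x \<longrightarrow>
        (\<forall>P. (\<forall>p \<in> P. path_between G w x p) \<and> edge_disjoint P \<longrightarrow> finite P \<and> card P \<le> 4)))"
proof -
  obtain f where "k_flow 3 G f" using assms(2) by blast
  then have "eulerian_graph G \<and> at_most_4_paths G" if "k_flow_connected 3 G"
    using that k_flow_connected_imp_eulerian[OF assms(1)] k_flow_connected_imp_at_most_4_paths[OF assms(1)]
    by blast
  moreover have "A_flow_connected TYPE(3) G" if "eulerian_graph G \<and> at_most_4_paths G"
    using that at_most_4_paths_imp_A_flow_connected[OF assms(1)] by blast
  moreover have "k_flow_connected 3 G" if "A_flow_connected TYPE(3) G"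
    using that by (rule A_flow_connected_imp_k_flow_connected[OF assms(1)])
  ultimately show ?thesis by blast
qed

end
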